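(* Let $q>1$, $0<u<1$, and let $n\ge 0$ be an integer. Consider the following randomized procedure, with state consisting of an integer $N\ge 1$, an integer $m\ge 0$ (the number of boxes still to be added) and a partition $\lambda$. Step 0: Start with $N=1$, $m=n$ and $\lambda$ the empty partition. Step 1: If $m=0$ then stop and output $\lambda$. Otherwise set $h=1-\frac{1}{q^{m}}$. Step 2: Flip a coin (independently of everything so far) with probability of heads $h$. Step 2a: If the toss of Step 2 came up tails, increase the value of $N$ by $1$ and go to Step 2. Step 2b: If the toss of Step 2 came up heads, decrease the value of $m$ by $1$ and choose a random integer $S>0$ according to the following rule: $S=1$ with probability $\frac{q^{N-\lambda_1'}-1}{q^N-1}$, and $S=s$ for $s>1$ with probability $\frac{q^{N-\lambda_s'}-q^{N-\lambda_{s-1}'}}{q^N-1}$. Then increase the size of column $S$ of $\lambda$ by $1$, and go to Step 1. Then the output of this procedure is a random partition of $n$ whose distribution is the probability measure $M_{GL,u,q}$ conditioned on the event $|\lambda|=n$.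
   Context: For a partition $\lambda$ with parts $\lambda_1\ge\lambda_2\ge\cdots\ge 0$, $|\lambda|$ is the sum of its parts, $m_i(\lambda)$ is the number of parts of size $i$, and $\lambda_i'=m_i(\lambda)+m_{i+1}(\lambda)+\cdots$ is the size of the $i$th column of the diagram of $\lambda$ (so $\lambda'_i=0$ for all large $i$). Write $(\frac{1}{q})_i=(1-\frac1q)(1-\frac{1}{q^2})\cdots(1-\frac1{q^i})$, with $(\frac1q)_0=1$. For $q>1$ and $0<u<1$, $M_{GL,u,q}$ is the probability measure on the set of all partitions of all natural numbers (including the empty partition) given by $$M_{GL,u,q}(\lambda)=\prod_{r=1}^{\infty}\left(1-\frac{u}{q^r}\right)\frac{u^{|\lambda|}}{q^{\sum_i(\lambda_i')^2}\prod_i(\frac1q)_{m_i(\lambda)}}.$$ *)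

theory Defs
  imports "HOL-Probability.Probability"
begin

text \<open>Integer partitions, as finite multisets of positive parts.\<close>

typedef partition = "{A :: nat multiset. 0 \<notin># A}"
  morphisms parts Abs_partition
  by (rule exI[of _ "{#}"]) simp

setup_lifting type_definition_partition

lift_definition empty_partition :: partition is "{#}"
  by simp

definition psize :: "partition \<Rightarrow> nat" where
  "psize p = sum_mset (parts p)"

definition part_mult :: "partition \<Rightarrow> nat \<Rightarrow> nat" where
  "part_mult p i = count (parts p) i"

text \<open>Columns are numbered from 1; only \<^term>\<open>i \<ge> 1\<close> is meaningful.\<close>

definition col :: "partition \<Rightarrow> nat \<Rightarrow> nat" where
  "col p i = size {#j \<in># parts p. i \<le> j#}"

text \<open>
  Increasing the size of column \<open>s\<close> by one creates a part 1 if \<open>s = 1\<close>, and otherwise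
  enlarges a part of size \<open>s - 1\<close> to \<open>s\<close>.  The result is a partition with the expected
  columns whenever a box can be added there; see \<open>col_add_box\<close> below.
\<close>

lift_definition add_box :: "nat \<Rightarrow> partition \<Rightarrow> partition" is
  "\<lambda>s A. if s = 0 then A
         else if s = 1 then add_mset 1 A
         else add_mset s (A - {#s - 1#})"
  by (auto dest: in_diffD)

lemma col_add_box:
  assumes "s \<ge> 1" and "s = 1 \<or> col p s < col p (s - 1)" and "i \<ge> 1"
  shows "col (add_box s p) i = col p i + (if i = s then 1 else 0)"
proof (cases "s = 1")
  case True
  then show ?thesis
    using assms by (simp add: col_def add_box.rep_eq)
next
  case False
  then have s: "s \<ge> 2" and lt: "col p s < col p (s - 1)"
    using assms by auto
  have mem: "s - 1 \<in># parts p"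
  proof (rule ccontr)
    assume *: "s - 1 \<notin># parts p"
    have "{#j \<in># parts p. s - 1 \<le> j#} = {#j \<in># parts p. s \<le> j#}"
    proof (rule filter_mset_cong[OF refl])
      fix j assume "j \<in># parts p"
      with * have "j \<noteq> s - 1" by auto
      with s show "s - 1 \<le> j \<longleftrightarrow> s \<le> j" by auto
    qed
    then show False using lt by (simp add: col_def)
  qed
  then obtain B where B: "parts p = add_mset (s - 1) B"
    by (metis multi_member_split)
  show ?thesis
    using s assms(3) by (auto simp: col_def add_box.rep_eq B)
qed

text \<open>
  The measure \<open>M\<^bsub>GL,u,q\<^esub>\<close>.  Columns and multiplicities with index larger than
  \<^term>\<open>psize p\<close> vanish, so the sum and the product over all \<open>i \<ge> 1\<close> may be truncated there.
\<close>

definition qfac :: "real \<Rightarrow> nat \<Rightarrow> real" where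
  "qfac q i = (\<Prod>k=1..i. 1 - 1 / q ^ k)"

definition GL_mass :: "real \<Rightarrow> real \<Rightarrow> partition \<Rightarrow> real" where
  "GL_mass u q p =
     (\<Prod>r. 1 - u / q ^ Suc r) *
     (u ^ psize p /
       (q ^ (\<Sum>i=1..psize p. (col p i)\<^sup>2) * (\<Prod>i=1..psize p. qfac q (part_mult p i))))"

definition M_GL :: "real \<Rightarrow> real \<Rightarrow> partition measure" where
  "M_GL u q = point_measure UNIV (\<lambda>p. ennreal (GL_mass u q p))"

text \<open>
  The law of the column index \<open>S\<close>.  The weights form a probability vector whenever
  \<open>N \<ge> 1\<close> and \<open>N \<ge> col p 1\<close> (see \<open>pmf_column_pmf\<close>), an invariant of the procedure
  (see \<open>column_invariant\<close>).
\<close>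

definition column_weight :: "real \<Rightarrow> nat \<Rightarrow> partition \<Rightarrow> nat \<Rightarrow> real" where
  "column_weight q N p s =
     (if s = 0 then 0
      else if s = 1 then (q powi (int N - int (col p 1)) - 1) / (q ^ N - 1)
      else (q powi (int N - int (col p s)) - q powi (int N - int (col p (s - 1)))) / (q ^ N - 1))"

definition column_pmf :: "real \<Rightarrow> nat \<Rightarrow> partition \<Rightarrow> nat pmf" where
  "column_pmf q N p = embed_pmf (column_weight q N p)"

lemma col_antimono: "i \<le> j \<Longrightarrow> col p j \<le> col p i"
  unfolding col_def
  by (intro size_mset_mono filter_mset_mono_strong) auto

lemma col_eq_0:
  assumes "psize p < i"
  shows "col p i = 0"
proof -
  have "j \<le> psize p" if "j \<in># parts p" for j
    using that unfolding psize_def by (metis le_add1 multi_member_split sum_mset.add_mset)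
  then show ?thesis
    using assms by (fastforce simp: col_def filter_mset_eq_conv)
qed

lemma column_weight_nonneg:
  assumes "q > 1" "N \<ge> 1" "col p 1 \<le> N"
  shows "column_weight q N p s \<ge> 0"
proof -
  have "q ^ N > 1" using assms by (simp add: one_less_power)
  moreover have "q powi (int N - int (col p 1)) \<ge> 1"
    using assms by (simp add: power_int_def)
  moreover have "q powi (int N - int (col p (s - 1))) \<le> q powi (int N - int (col p s))"
    using assms col_antimono[of "s - 1" s p] by (intro power_int_increasing) auto
  ultimately show ?thesis
    by (simp add: column_weight_def)
qed

lemma sum_column_weight:
  "(\<Sum>s\<le>k + 1. column_weight q N p s) = (q powi (int N - int (col p (k + 1))) - 1) / (q ^ N - 1)"
  by (induction k) (auto simp: column_weight_def diff_divide_distrib)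

lemma pmf_column_pmf:
  assumes "q > 1" "N \<ge> 1" "col p 1 \<le> N"
  shows "pmf (column_pmf q N p) s = column_weight q N p s"
proof -
  have z: "column_weight q N p s = 0" if "s \<notin> {..psize p + 1}" for s
    using that by (simp add: column_weight_def col_eq_0)
  have "q ^ N > 1" using assms by (simp add: one_less_power)
  then have 1: "(\<Sum>s\<le>psize p + 1. column_weight q N p s) = 1"
    unfolding sum_column_weight by (simp add: col_eq_0)
  have "(\<integral>\<^sup>+ s. ennreal (column_weight q N p s) \<partial>count_space UNIV) =
        (\<Sum>s\<le>psize p + 1. ennreal (column_weight q N p s))"
    by (rule nn_integral_count_space') (auto simp: z)
  also have "\<dots> = 1"
    by (subst sum_ennreal) (use 1 column_weight_nonneg[OF assms] in auto)
  finally show ?thesis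
    unfolding column_pmf_def using column_weight_nonneg[OF assms] by (intro pmf_embed_pmf) auto
qed

lemma column_invariant:
  assumes "q > 1" "N \<ge> 1" "col p 1 \<le> N" and s: "s \<in> set_pmf (column_pmf q N p)"
  shows "s \<ge> 1" and "s = 1 \<or> col p s < col p (s - 1)" and "col (add_box s p) 1 \<le> N"
proof -
  have nz: "column_weight q N p s \<noteq> 0"
    using s pmf_column_pmf[OF assms(1-3)] by (metis set_pmf_iff)
  then show s1: "s \<ge> 1" by (cases "s = 0") (auto simp: column_weight_def)
  show s2: "s = 1 \<or> col p s < col p (s - 1)"
  proof (rule ccontr)
    assume "\<not> ?thesis"
    with col_antimono[of "s - 1" s p] have "s \<noteq> 1" "col p s = col p (s - 1)" by auto
    with nz show False by (simp add: column_weight_def split: if_splits)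
  qed
  have "col p 1 < N" if "s = 1"
    using nz that assms(3) by (cases "col p 1 = N") (auto simp: column_weight_def)
  then show "col (add_box s p) 1 \<le> N"
    using col_add_box[OF s1 s2, of 1] assms(3) by auto
qed

text \<open>
  The procedure, started in state \<open>(N, m, p)\<close> with \<open>m\<close> boxes still to be added.  After
  tails the bias of the coin is unchanged because \<open>m\<close> is.  The function is the least fixed
  point in the order of subprobability mass functions, so \<^term>\<open>run q N m p\<close> gives each output
  the probability that the procedure stops with it, and the missing mass is the
  probability of running forever.
\<close>

partial_function (spmf) run :: "real \<Rightarrow> nat \<Rightarrow> nat \<Rightarrow> partition \<Rightarrow> partition spmf" where
  "run q N m p =
     (if m = 0 then return_spmf p
      else bind_spmf (spmf_of_pmf (bernoulli_pmf (1 - 1 / q ^ m))) (\<lambda>heads.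
        if heads
        then bind_spmf (spmf_of_pmf (column_pmf q N p)) (\<lambda>S. run q N (m - 1) (add_box S p))
        else run q (N + 1) m p))"

definition procedure_output :: "real \<Rightarrow> nat \<Rightarrow> partition spmf" where
  "procedure_output q n = run q 1 n empty_partition"

end

theory Submission
  imports Defs
begin

text \<open>
  Let \<open>p\<close> be a partition of \<open>k \<le> n\<close>.  The probability that the partition is \<open>p\<close> when stage \<open>N\<close>
  is left (by tails, or because no boxes remain) has a closed form: the weight of \<open>p\<close> in
  the measure, times a factor that depends only on \<open>N\<close>, \<open>k\<close> and the size of the first
  column of \<open>p\<close>.  The transition probabilities satisfy the resulting balance
  equation because, summed over the removable boxes, they telescope along the columns of
  \<open>p\<close>.  Hence the expected output probability, averaged over the partition at the end
  of stage \<open>N\<close>, does not depend on \<open>N\<close>.  As \<open>N \<rightarrow> \<infinity>\<close> all mass with \<open>k < n\<close> disappears, which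
  shows that the output law is proportional to the weights.  Almost sure termination then
  determines the normalising constant.
\<close>

section \<open>Adding and removing boxes\<close>

text \<open>Removable boxes correspond to the distinct part sizes, which is why sums over the
  predecessors of \<open>p\<close> run over \<open>set_mset (parts p)\<close>.\<close>

lift_definition remove_box :: "nat \<Rightarrow> partition \<Rightarrow> partition" is
  "\<lambda>s A. if s \<le> 1 then A - {#1#} else add_mset (s - 1) (A - {#s#})"
  by (auto dest: in_diffD)

definition addable :: "nat \<Rightarrow> partition \<Rightarrow> bool" where
  "addable s p \<longleftrightarrow> s = 1 \<or> 2 \<le> s \<and> s - 1 \<in># parts p"

lemma zero_not_part [simp]: "0 \<notin># parts p"
  using parts[of p] by simp

lemma part_pos: "s \<in># parts p \<Longrightarrow> 1 \<le> s"
  using zero_not_part[of p] by (cases s) auto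

lemma part_le_psize: "s \<in># parts p \<Longrightarrow> s \<le> psize p"
  unfolding psize_def by (metis le_add1 multi_member_split sum_mset.add_mset)

lemma psize_eq_0 [simp]: "psize p = 0 \<longleftrightarrow> p = empty_partition"
proof
  assume "psize p = 0"
  then have "s \<notin># parts p" for s
    using part_le_psize[of s p] part_pos[of s p] by auto
  then have "parts p = {#}"
    by (metis multiset_nonemptyE)
  then show "p = empty_partition"
    by (simp add: parts_inject[symmetric] empty_partition.rep_eq)
qed (simp add: psize_def empty_partition.rep_eq)

lemma psize_empty [simp]: "psize empty_partition = 0"
  by simp

lemma obtain_part:
  assumes "p \<noteq> empty_partition"
  obtains s where "s \<in># parts p"
  using assms by (metis empty_partition.rep_eq multiset_nonemptyE parts_inject)

lemma col_eq_part_mult_plus: "col p i = part_mult p i + col p (Suc i)"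
proof -
  have "{#j \<in># parts p. i \<le> j#} = {#j \<in># parts p. j = i#} + {#j \<in># parts p. Suc i \<le> j#}"
    by (rule multiset_eqI) auto
  then show ?thesis
    by (simp add: col_def part_mult_def filter_eq_replicate_mset)
qed

lemma addable_ge_1: "addable s p \<Longrightarrow> 1 \<le> s"
  by (auto simp: addable_def)

text \<open>Adjacent columns differ by a multiplicity. This links the multiset form to the column
  condition in \<open>col_add_box\<close> and \<open>column_invariant\<close>.\<close>

lemma addable_iff_col: "addable s p \<longleftrightarrow> 1 \<le> s \<and> (s = 1 \<or> col p s < col p (s - 1))"
  using col_eq_part_mult_plus[of p "s - 1"]
  by (cases s) (auto simp: addable_def part_mult_def simp flip: count_greater_zero_iff)

lemma add_remove_box:
  assumes "s \<in># parts p"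
  shows "add_box s (remove_box s p) = p" "addable s (remove_box s p)"
  using assms part_pos[OF assms]
  by (auto simp: parts_inject[symmetric] add_box.rep_eq remove_box.rep_eq addable_def)

lemma remove_add_box:
  assumes "addable s p"
  shows "remove_box s (add_box s p) = p"
  using assms
  by (auto simp: parts_inject[symmetric] add_box.rep_eq remove_box.rep_eq addable_def)

lemma part_add_box: "addable s p \<Longrightarrow> s \<in># parts (add_box s p)"
  by (auto simp: add_box.rep_eq addable_def)

lemma part_mult_add_box:
  assumes "addable s p"
  shows "part_mult (add_box s p) s = Suc (part_mult p s)"
    and "2 \<le> s \<Longrightarrow> part_mult p (s - 1) = Suc (part_mult (add_box s p) (s - 1))"
    and "i \<noteq> s \<Longrightarrow> i \<noteq> s - 1 \<Longrightarrow> part_mult (add_box s p) i = part_mult p i"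
  using assms
  by (auto simp: part_mult_def add_box.rep_eq addable_def)

lemma col_addable_box:
  assumes "addable s p" "1 \<le> i"
  shows "col (add_box s p) i = col p i + (if i = s then 1 else 0)"
  using assms by (intro col_add_box) (auto simp: addable_iff_col)

lemma psize_add_box:
  assumes "addable s p"
  shows "psize (add_box s p) = Suc (psize p)"
proof (cases "s = 1")
  case True
  then show ?thesis by (simp add: psize_def add_box.rep_eq)
next
  case False
  with assms have "2 \<le> s" "s - 1 \<in># parts p"
    by (auto simp: addable_def)
  then obtain B where "parts p = add_mset (s - 1) B"
    by (metis multi_member_split)
  with \<open>2 \<le> s\<close> show ?thesis
    by (simp add: psize_def add_box.rep_eq)
qed

lemma psize_remove_box: "s \<in># parts p \<Longrightarrow> Suc (psize (remove_box s p)) = psize p"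
  using psize_add_box[OF add_remove_box(2)] add_remove_box(1) by metis

text \<open>Induction on \<open>n\<close>: a nonempty partition of size at most \<open>Suc n\<close>
  arises from a smaller one by adding a box in one of finitely many columns.\<close>

lemma finite_psize_le: "finite {p. psize p \<le> n}"
proof (induction n)
  case (Suc n)
  have "{p. psize p \<le> Suc n} \<subseteq>
      insert empty_partition (\<Union>s\<in>{..Suc n}. add_box s ` {p. psize p \<le> n})"
  proof
    fix p assume p: "p \<in> {p. psize p \<le> Suc n}"
    show "p \<in> insert empty_partition (\<Union>s\<in>{..Suc n}. add_box s ` {p. psize p \<le> n})"
    proof (cases "p = empty_partition")
      case False
      then obtain s where s: "s \<in># parts p" by (rule obtain_part)
      then have "s \<le> Suc n" "psize (remove_box s p) \<le> n"
        using p part_le_psize[OF s] psize_remove_box[OF s] by auto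
      then show ?thesis
        using add_remove_box(1)[OF s] by (auto intro!: bexI[of _ s] image_eqI)
    qed simp
  qed
  with Suc show ?case
    by (meson finite.insertI finite_UN finite_atMost finite_imageI finite_subset)
qed simp

section \<open>The weight of a partition and its change under adding a box\<close>

text \<open>This is \<open>GL_mass\<close> without the infinite product and the power of
  \<open>u\<close>, both of which are constant on partitions of a fixed size.\<close>

definition gl_weight :: "real \<Rightarrow> partition \<Rightarrow> real" where
  "gl_weight q p =
     1 / (q ^ (\<Sum>i=1..psize p. (col p i)\<^sup>2) * (\<Prod>i=1..psize p. qfac q (part_mult p i)))"

lemma part_mult_eq_0: "psize p < i \<Longrightarrow> part_mult p i = 0"
  using part_le_psize[of i p] by (force simp: part_mult_def not_in_iff)

lemma qfac_0 [simp]: "qfac q 0 = 1"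
  by (simp add: qfac_def)

lemma qfac_Suc: "qfac q (Suc i) = qfac q i * (1 - 1 / q ^ Suc i)"
  by (simp add: qfac_def)

lemma qfac_pos: "q > 1 \<Longrightarrow> qfac q i > 0"
  unfolding qfac_def by (intro prod_pos) (auto simp: field_simps intro!: one_less_power)

text \<open>Columns and multiplicities beyond \<open>psize p\<close> vanish. A common bound
  \<open>K\<close> makes the weights of \<open>p\<close> and \<open>add_box s p\<close> comparable
  factor by factor.\<close>

lemma gl_weight_bound:
  assumes "psize p \<le> K"
  shows "gl_weight q p =
     1 / (q ^ (\<Sum>i=1..K. (col p i)\<^sup>2) * (\<Prod>i=1..K. qfac q (part_mult p i)))"
proof -
  have "(\<Sum>i=1..psize p. (col p i)\<^sup>2) = (\<Sum>i=1..K. (col p i)\<^sup>2)"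
    using assms by (intro sum.mono_neutral_left) (auto simp: col_eq_0)
  moreover have "(\<Prod>i=1..psize p. qfac q (part_mult p i)) = (\<Prod>i=1..K. qfac q (part_mult p i))"
    using assms by (intro prod.mono_neutral_left) (auto simp: part_mult_eq_0)
  ultimately show ?thesis by (simp add: gl_weight_def)
qed

lemma gl_weight_pos: "q > 1 \<Longrightarrow> gl_weight q p > 0"
  unfolding gl_weight_def by (auto intro!: divide_pos_pos mult_pos_pos prod_pos qfac_pos)

text \<open>Only column \<open>s\<close> grows, which raises its square by
  \<open>2 * col p s + 1\<close>, and only the multiplicities of \<open>s\<close> and
  \<open>s - 1\<close> change, each altering one factor of a \<open>qfac\<close>.\<close>

lemma gl_weight_add_box:
  assumes "q > 1" and s: "addable s p"
  shows "gl_weight q p * (if s = 1 then 1 else 1 - 1 / q ^ part_mult p (s - 1)) =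
         gl_weight q (add_box s p) * q ^ (2 * col p s + 1)
           * (1 - 1 / q ^ part_mult (add_box s p) s)"
proof -
  define p' where "p' = add_box s p"
  define K where "K = psize p'"
  define d e where "d = 1 - 1 / q ^ part_mult p (s - 1)" and "e = 1 - 1 / q ^ part_mult p' s"
  have K: "psize p \<le> K" "psize p' \<le> K"
    using psize_add_box[OF s] by (auto simp: K_def p'_def)
  have sK: "s \<in> {1..K}" "1 \<le> s"
    using part_le_psize[OF part_add_box[OF s]] addable_ge_1[OF s] by (auto simp: K_def p'_def)
  have "(\<Sum>i=1..K. (col p' i)\<^sup>2) = (\<Sum>i=1..K. (col p i)\<^sup>2 + (if i = s then 2 * col p s + 1 else 0))"
    by (intro sum.cong refl)
       (use col_addable_box[OF s] in \<open>auto simp: p'_def power2_eq_square\<close>)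
  also have "\<dots> = (\<Sum>i=1..K. (col p i)\<^sup>2) + (2 * col p s + 1)"
    using sK by (simp add: sum.distrib)
  finally have sq: "(\<Sum>i=1..K. (col p' i)\<^sup>2) = (\<Sum>i=1..K. (col p i)\<^sup>2) + (2 * col p s + 1)" .
  \<comment> \<open>The correction \<open>d\<close> restores the factor lost at index
    \<open>s - 1\<close>, and \<open>e\<close> supplies the one gained at \<open>s\<close>, so the
    two products agree termwise.\<close>
  have "(\<Prod>i=1..K. qfac q (part_mult p' i) * (if i = s - 1 then d else 1)) =
        (\<Prod>i=1..K. qfac q (part_mult p i) * (if i = s then e else 1))"
  proof (intro prod.cong refl)
    fix i assume i: "i \<in> {1..K}"
    consider "i = s" | "i = s - 1" "2 \<le> s" | "i \<noteq> s" "i \<noteq> s - 1"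
      using i by force
    then show "qfac q (part_mult p' i) * (if i = s - 1 then d else 1) =
               qfac q (part_mult p i) * (if i = s then e else 1)"
    proof cases
      case 1
      then show ?thesis
        using part_mult_add_box(1)[OF s] sK by (simp add: p'_def e_def qfac_Suc)
    next
      case 2
      then show ?thesis
        using part_mult_add_box(2)[OF s] sK by (simp add: p'_def d_def qfac_Suc)
    next
      case 3
      then show ?thesis
        using part_mult_add_box(3)[OF s] by (simp add: p'_def)
    qed
  qed
  moreover have "s - 1 \<in> {1..K} \<longleftrightarrow> s \<noteq> 1"
    using sK by auto
  ultimately have pr: "(\<Prod>i=1..K. qfac q (part_mult p' i)) * (if s = 1 then 1 else d) =
        (\<Prod>i=1..K. qfac q (part_mult p i)) * e"
    using sK by (simp add: prod.distrib split: if_splits)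
  have pos: "(\<Prod>i=1..K. qfac q (part_mult p i)) > 0" "(\<Prod>i=1..K. qfac q (part_mult p' i)) > 0"
    using assms by (auto intro!: prod_pos qfac_pos)
  have frac: "1 / (S * X) * D = 1 / (S * T * X') * T * e"
    if "X' * D = X * e" "X > 0" "X' > 0" "S > 0" "T > 0" for S T X X' D :: real
  proof -
    have "D / X = e / X'"
      using that by (simp add: frac_eq_eq mult.commute)
    moreover have "1 / (S * X) * D = D / X / S" "1 / (S * T * X') * T * e = e / X' / S"
      using that by simp_all
    ultimately show ?thesis by simp
  qed
  show ?thesis
    unfolding gl_weight_bound[OF K(1)] gl_weight_bound[OF K(2)] p'_def[symmetric]
      d_def[symmetric] e_def[symmetric] sq power_add[of q "\<Sum>i=1..K. (col p i)\<^sup>2"]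
    by (rule frac[OF pr pos]) (use \<open>q > 1\<close> in simp_all)
qed

section \<open>Falling products in 1/q\<close>

text \<open>For \<open>l \<le> N\<close> this is \<open>qfac q N / qfac q (N - l)\<close>; for a
  prime power \<open>q\<close> it is the probability that a random \<open>N\<close> by
  \<open>l\<close> matrix over the field with \<open>q\<close> elements has rank
  \<open>l\<close>.\<close>

definition qfall :: "real \<Rightarrow> nat \<Rightarrow> nat \<Rightarrow> real" where
  "qfall q N l = (\<Prod>j<l. 1 - 1 / q ^ (N - j))"

lemma qfall_Suc: "qfall q N (Suc l) = qfall q N l * (1 - 1 / q ^ (N - l))"
  by (simp add: qfall_def)

lemma qfall_eq_0: "N < l \<Longrightarrow> qfall q N l = 0"
  unfolding qfall_def by (intro prod_zero) auto

lemma qfall_diff: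
  assumes "q > 1"
  shows "(q ^ Suc N - 1) * (qfall q (Suc N) l - qfall q N l) = (q ^ l - 1) * qfall q (Suc N) l"
proof (cases "l \<le> Suc N")
  case True
  \<comment> \<open>Here the first factor is split off, whereas \<open>qfall_Suc\<close> splits off
    the last; comparing the two relates \<open>Suc N\<close> to \<open>N\<close>.\<close>
  have "qfall q (Suc N) (Suc l) = (1 - 1 / q ^ Suc N) * qfall q N l"
    by (simp only: qfall_def prod.lessThan_Suc_shift) simp
  moreover have "q ^ Suc N = q ^ l * q ^ (Suc N - l)"
    using True by (metis le_add_diff_inverse power_add)
  moreover have "q ^ Suc N > 0" "q ^ (Suc N - l) > 0"
    using assms by (auto intro: zero_less_power)
  moreover have "(c - 1) * (F - G) = (a - 1) * F"
    if "F * (1 - 1 / b) = (1 - 1 / c) * G" "c = a * b" "c > 0" "b > 0" for a b c F G :: real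
  proof -
    have "F * (b - 1) * a = F * (1 - 1 / b) * c"
      using that(2,4) by (simp add: field_simps)
    also have "\<dots> = (c - 1) * G"
      unfolding that(1) using that(3) by (simp add: field_simps)
    finally show ?thesis using that(2) by (simp add: algebra_simps)
  qed
  ultimately show ?thesis
    unfolding qfall_Suc by blast
next
  case False
  then show ?thesis by (simp add: qfall_eq_0)
qed

lemma qfall_tendsto_1:
  assumes "q > 1"
  shows "(\<lambda>N. qfall q N l) \<longlonglongrightarrow> 1"
proof -
  have "(\<lambda>N. 1 - 1 / q ^ (N - j)) \<longlonglongrightarrow> 1" for j
  proof -
    have "(\<lambda>N. 1 - inverse q ^ (N - j)) \<longlonglongrightarrow> 1 - 0"
      using assms filterlim_minus_const_nat_at_top[of j]
      by (intro tendsto_intros filterlim_compose[OF LIMSEQ_power_zero])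
         (auto simp: field_simps)
    then show ?thesis by (simp add: inverse_eq_divide power_one_over)
  qed
  then have "(\<lambda>N. \<Prod>j<l. 1 - 1 / q ^ (N - j)) \<longlonglongrightarrow> (\<Prod>j<l. 1)"
    by (intro tendsto_prod) auto
  then show ?thesis by (simp add: qfall_def)
qed

section \<open>Transition weights and the telescoping balance\<close>

text \<open>Combined with \<open>gl_weight_add_box\<close>, the column weight becomes a difference
  of powers at adjacent columns of the new partition, the form in which the sum over removable boxes
  telescopes.\<close>

lemma transition_weight:
  assumes "q > 1" "N \<ge> 1" and s: "addable s p"
  defines "p' \<equiv> add_box s p"
  shows "gl_weight q p * qfall q N (col p 1) * column_weight q N p s * (q ^ N - 1) =
         gl_weight q p' * qfall q N (col p' 1) * q ^ N * (q ^ col p' s - q ^ col p' (Suc s))"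
proof (cases "col p 1 \<le> N")
  case False
  moreover have "col p 1 \<le> col p' 1"
    using col_addable_box[OF s] by (simp add: p'_def)
  ultimately show ?thesis by (simp add: qfall_eq_0)
next
  case True
  define d where "d = (if s = 1 then 1 else 1 - 1 / q ^ part_mult p (s - 1))"
  define c where "c = col p s"
  have s1: "1 \<le> s" using s by (rule addable_ge_1)
  have cN: "c \<le> N" using col_antimono[OF s1, of p] True by (simp add: c_def)
  have qN: "q ^ N > 1" using assms by (simp add: one_less_power)
  have qm: "q ^ N = q ^ c * q ^ (N - c)"
    using cN by (metis le_add_diff_inverse power_add)
  have q0: "q ^ i > 0" for i using assms by simp
  \<comment> \<open>For \<open>s = 1\<close> the column weight supplies the extra factor of
    \<open>qfall\<close> caused by the longer first column; for \<open>s > 1\<close> the first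
    column is unchanged and the weight supplies \<open>d\<close>.\<close>
  have W: "qfall q N (col p 1) * (column_weight q N p s * (q ^ N - 1)) =
        q ^ (N - c) * d * qfall q N (col p' 1)"
  proof (cases "s = 1")
    case True
    then have "col p' 1 = Suc c"
      using col_addable_box[OF s, of 1] by (simp add: p'_def c_def)
    moreover have "column_weight q N p s * (q ^ N - 1) = q ^ (N - c) - 1"
      using qN cN True by (simp add: column_weight_def c_def power_int_def nat_diff_distrib)
    ultimately show ?thesis
      using True q0[of "N - c"]
      by (simp only: qfall_Suc d_def) (use \<open>q > 1\<close> in \<open>simp add: c_def right_diff_distrib\<close>)
  next
    case False
    then have s2: "2 \<le> s" using s1 by simp
    have cc: "col p (s - 1) = part_mult p (s - 1) + c"
      using col_eq_part_mult_plus[of p "s - 1"] s2 by (simp add: c_def)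
    have c'N: "col p (s - 1) \<le> N"
      using s2 by (intro order_trans[OF col_antimono True]) auto
    have "q ^ (N - c) = q ^ part_mult p (s - 1) * q ^ (N - col p (s - 1))"
      using c'N cc by (simp flip: power_add)
    moreover have "column_weight q N p s * (q ^ N - 1) = q ^ (N - c) - q ^ (N - col p (s - 1))"
      using qN cN c'N False s1
      by (simp add: column_weight_def c_def power_int_def nat_diff_distrib)
    moreover have "col p' 1 = col p 1"
      using col_addable_box[OF s, of 1] False by (simp add: p'_def)
    ultimately show ?thesis
      using False q0[of "part_mult p (s - 1)"] \<open>q > 1\<close>
      by (simp add: d_def left_diff_distrib right_diff_distrib)
  qed
  have c': "col p' s = Suc c" "col p' s = part_mult p' s + col p' (Suc s)"
    using col_addable_box[OF s s1] col_eq_part_mult_plus[of p' s] by (simp_all add: p'_def c_def)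
  have "gl_weight q p * qfall q N (col p 1) * column_weight q N p s * (q ^ N - 1) =
      (gl_weight q p * d) * (q ^ (N - c) * qfall q N (col p' 1))"
    using W by (simp add: algebra_simps)
  also have "gl_weight q p * d =
      gl_weight q p' * q ^ (2 * c + 1) * (1 - 1 / q ^ part_mult p' s)"
    using gl_weight_add_box[OF \<open>q > 1\<close> s] by (simp add: p'_def d_def c_def)
  also have "q ^ (2 * c + 1) = q ^ c * q ^ col p' s"
    using c' by (simp flip: power_add add: mult_2)
  also have "gl_weight q p' * (q ^ c * q ^ col p' s) * (1 - 1 / q ^ part_mult p' s)
      * (q ^ (N - c) * qfall q N (col p' 1)) =
      gl_weight q p' * qfall q N (col p' 1) * (q ^ c * q ^ (N - c))
      * (q ^ col p' s - q ^ col p' s / q ^ part_mult p' s)"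
    by (simp add: algebra_simps)
  also have "q ^ col p' s / q ^ part_mult p' s = q ^ col p' (Suc s)"
    using \<open>q > 1\<close> by (simp add: c'(2) power_add)
  finally show ?thesis using qm by simp
qed

text \<open>Sizes that are not parts contribute zero because adjacent columns agree there, so the
  sum extends to all columns and telescopes.\<close>

lemma sum_col_diff:
  "(\<Sum>s\<in>set_mset (parts p). (q::real) ^ col p s - q ^ col p (Suc s)) = q ^ col p 1 - 1"
proof -
  have "(\<Sum>s\<in>set_mset (parts p). q ^ col p s - q ^ col p (Suc s)) =
        (\<Sum>s=1..psize p. q ^ col p s - q ^ col p (Suc s))"
  proof (intro sum.mono_neutral_left ballI)
    fix s assume "s \<in> {1..psize p} - set_mset (parts p)"
    then have "part_mult p s = 0" by (auto simp: part_mult_def not_in_iff)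
    then show "q ^ col p s - q ^ col p (Suc s) = 0"
      using col_eq_part_mult_plus[of p s] by simp
  qed (use part_le_psize part_pos in auto)
  also have "\<dots> = q ^ col p 1 - q ^ col p (Suc (psize p))"
    using sum_Suc_diff[of 1 "psize p" "\<lambda>i. - (q ^ col p i)"] by simp
  finally show ?thesis by (simp add: col_eq_0)
qed

text \<open>Summing \<open>transition_weight\<close> over the removable boxes yields
  \<open>q ^ col p 1 - 1\<close>, which \<open>qfall_diff\<close> turns into an increment of
  \<open>qfall\<close>.\<close>

lemma weight_balance:
  assumes "q > 1"
  shows "q ^ Suc N * gl_weight q p * (qfall q (Suc N) (col p 1) - qfall q N (col p 1)) =
    (\<Sum>s\<in>set_mset (parts p). gl_weight q (remove_box s p) *
        qfall q (Suc N) (col (remove_box s p) 1) * column_weight q (Suc N) (remove_box s p) s)"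
    (is "?L = ?R")
proof -
  have "?R * (q ^ Suc N - 1) =
    (\<Sum>s\<in>set_mset (parts p). gl_weight q p * qfall q (Suc N) (col p 1) * q ^ Suc N
        * (q ^ col p s - q ^ col p (Suc s)))"
    unfolding sum_distrib_right
  proof (intro sum.cong refl)
    fix s assume s: "s \<in># parts p"
    show "gl_weight q (remove_box s p) * qfall q (Suc N) (col (remove_box s p) 1)
        * column_weight q (Suc N) (remove_box s p) s * (q ^ Suc N - 1) =
        gl_weight q p * qfall q (Suc N) (col p 1) * q ^ Suc N * (q ^ col p s - q ^ col p (Suc s))"
      using transition_weight[OF assms _ add_remove_box(2)[OF s], of "Suc N"]
      by (simp only: add_remove_box(1)[OF s])
  qed
  also have "\<dots> = gl_weight q p * q ^ Suc N * ((q ^ col p 1 - 1) * qfall q (Suc N) (col p 1))"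
    by (simp only: sum_distrib_left[symmetric] sum_col_diff) (simp only: mult_ac)
  also have "\<dots> = ?L * (q ^ Suc N - 1)"
    by (simp only: qfall_diff[OF assms, symmetric]) (simp only: mult_ac)
  finally have "?R * (q ^ Suc N - 1) = ?L * (q ^ Suc N - 1)" .
  moreover have "q ^ Suc N > 1"
    using assms by (intro one_less_power) auto
  ultimately show ?thesis by simp
qed

section \<open>Stage and visit probabilities\<close>

text \<open>
  \<open>stage_prob q n N p\<close> is the probability that stage \<open>N\<close> ends with partition \<open>p\<close>.  Since tails
  has probability \<open>1 / q ^ (n - psize p)\<close>, the probability \<open>visit_prob q n N p\<close> of reaching \<open>p\<close>
  during stage \<open>N\<close> is larger by the inverse factor.  If \<open>col p 1 > N\<close>, both vanish, because
  \<open>qfall\<close> (with truncated subtraction) then contains the factor \<open>1 - 1 / q ^ 0\<close>.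
\<close>

definition stage_prob :: "real \<Rightarrow> nat \<Rightarrow> nat \<Rightarrow> partition \<Rightarrow> real" where
  "stage_prob q n N p =
     qfac q n / qfac q (n - psize p) * q ^ psize p / q ^ (N * (n - psize p))
       * (gl_weight q p * qfall q N (col p 1))"

definition visit_prob :: "real \<Rightarrow> nat \<Rightarrow> nat \<Rightarrow> partition \<Rightarrow> real" where
  "visit_prob q n N p = q ^ (n - psize p) * stage_prob q n N p"

text \<open>A visit during stage \<open>Suc N\<close> either carries over from the end of stage
  \<open>N\<close> or follows heads and the addition of a box. After common factors are removed this
  is \<open>weight_balance\<close>.\<close>

lemma visit_prob_balance:
  assumes "q > 1" "psize p \<le> n"
  shows "visit_prob q n (Suc N) p = stage_prob q n N p +
    (\<Sum>s\<in>set_mset (parts p). visit_prob q n (Suc N) (remove_box s p)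
        * (1 - 1 / q ^ (n - psize (remove_box s p))) * column_weight q (Suc N) (remove_box s p) s)"
proof -
  define k m where "k = psize p" and "m = n - psize p"
  define C where "C = qfac q n / qfac q m * q ^ k / q ^ (N * m)"
  have q0: "q > 0" using assms by simp
  have V: "visit_prob q n (Suc N) p = C * (gl_weight q p * qfall q (Suc N) (col p 1))"
    using q0 by (simp add: visit_prob_def stage_prob_def C_def k_def m_def power_add)
  have S: "stage_prob q n N p = C * (gl_weight q p * qfall q N (col p 1))"
    by (simp add: stage_prob_def C_def k_def m_def)
  \<comment> \<open>The predecessor has one more box to add; its heads probability cancels the
    additional factor of \<open>qfac\<close>, and the powers of \<open>q\<close> leave
    \<open>1 / q ^ Suc N\<close>.\<close>
  have R: "visit_prob q n (Suc N) (remove_box s p) * (1 - 1 / q ^ (n - psize (remove_box s p))) =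
      C / q ^ Suc N * (gl_weight q (remove_box s p) * qfall q (Suc N) (col (remove_box s p) 1))"
    if s: "s \<in># parts p" for s
  proof -
    have k: "k = Suc (psize (remove_box s p))"
      using psize_remove_box[OF s] by (simp add: k_def)
    then have m: "n - psize (remove_box s p) = Suc m"
      using assms(2) by (simp add: m_def k_def)
    have nz: "1 - 1 / q ^ Suc m \<noteq> 0"
      using one_less_power[OF assms(1), of "Suc m"] by (auto simp: field_simps)
    have cancel: "z * (a * (b / (c * z) * d / e)) = a * (b / c * d / e)" if "z \<noteq> 0"
      for z a b c d e :: real
      using that by simp
    have "visit_prob q n (Suc N) (remove_box s p) * (1 - 1 / q ^ Suc m) =
      (1 - 1 / q ^ Suc m) * (q ^ Suc m * (qfac q n / (qfac q m * (1 - 1 / q ^ Suc m)) * q ^ (k - 1)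
        / q ^ (Suc N * Suc m)))
        * (gl_weight q (remove_box s p) * qfall q (Suc N) (col (remove_box s p) 1))"
      by (simp only: visit_prob_def stage_prob_def m qfac_Suc) (simp add: k)
    also have "(1 - 1 / q ^ Suc m) * (q ^ Suc m * (qfac q n / (qfac q m * (1 - 1 / q ^ Suc m)) * q ^ (k - 1)
        / q ^ (Suc N * Suc m))) = q ^ Suc m * (qfac q n / qfac q m * q ^ (k - 1) / q ^ (Suc N * Suc m))"
      using nz by (rule cancel)
    also have "\<dots> = C / q ^ Suc N"
      using q0 k by (simp add: C_def power_add)
    finally show ?thesis by (simp only: m)
  qed
  have "(\<Sum>s\<in>set_mset (parts p). visit_prob q n (Suc N) (remove_box s p)
        * (1 - 1 / q ^ (n - psize (remove_box s p))) * column_weight q (Suc N) (remove_box s p) s)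
      = C / q ^ Suc N * (q ^ Suc N * gl_weight q p * (qfall q (Suc N) (col p 1) - qfall q N (col p 1)))"
    unfolding weight_balance[OF assms(1)] sum_distrib_left
    by (intro sum.cong refl) (simp add: R mult_ac)
  also have "\<dots> = C * (gl_weight q p * (qfall q (Suc N) (col p 1) - qfall q N (col p 1)))"
    using q0 by simp
  finally show ?thesis
    unfolding V S by (simp add: algebra_simps)
qed

section \<open>One step of the procedure and conservation across stages\<close>

lemma run_0: "run q N 0 p = return_spmf p"
  by (subst run.simps) simp

text \<open>In terms of \<open>bind_pmf\<close>, the outcome \<open>None\<close> (divergence) can be
  treated like any other outcome, as \<open>lossless_run\<close> does.\<close>

lemma run_pos:
  "0 < m \<Longrightarrow> run q N m p = bind_pmf (bernoulli_pmf (1 - 1 / q ^ m)) (\<lambda>heads.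
        if heads
        then bind_pmf (column_pmf q N p) (\<lambda>S. run q N (m - 1) (add_box S p))
        else run q (Suc N) m p)"
  by (subst run.simps) (simp cong: if_cong)

lemma pmf_bind_bernoulli:
  assumes "0 \<le> h" "h \<le> 1"
  shows "pmf (bind_pmf (bernoulli_pmf h) f) x =
         h * pmf (f True) x + (1 - h) * pmf (f False) x"
  using assms by (simp add: pmf_bind)

lemma pmf_bind_column:
  assumes "q > 1" "N \<ge> 1" "col p 1 \<le> N" "psize p < n"
  shows "pmf (bind_pmf (column_pmf q N p) f) x =
         (\<Sum>s | s \<in> {1..n} \<and> addable s p. column_weight q N p s * pmf (f s) x)"
proof -
  have sub: "s \<in> {1..n} \<and> addable s p" if "s \<in> set_pmf (column_pmf q N p)" for s
  proof -
    have ad: "addable s p"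
      using column_invariant[OF assms(1-3) that] by (simp add: addable_iff_col)
    then have "s \<le> Suc (psize p)"
      using part_le_psize[of "s - 1" p] by (auto simp: addable_def)
    with ad assms(4) show ?thesis
      by (auto dest: addable_ge_1)
  qed
  have "pmf (bind_pmf (column_pmf q N p) f) x =
      measure_pmf.expectation (column_pmf q N p) (\<lambda>s. pmf (f s) x)"
    by (rule pmf_bind)
  also have "\<dots> = (\<Sum>s | s \<in> {1..n} \<and> addable s p. pmf (f s) x * pmf (column_pmf q N p) s)"
    by (intro integral_measure_pmf_real) (use sub in auto)
  finally show ?thesis
    by (simp add: pmf_column_pmf[OF assms(1-3)] mult.commute)
qed

text \<open>Conditioning on the next toss: tails carries the mass \<open>stage_prob\<close> into the
  next stage, and heads distributes the rest over the addable columns.\<close>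

lemma visit_prob_run:
  assumes "q > 1" "psize p \<le> n" "N \<ge> 1"
  defines "h \<equiv> 1 - 1 / q ^ (n - psize p)"
  shows "visit_prob q n N p * spmf (run q N (n - psize p) p) x =
    stage_prob q n N p * spmf (run q (Suc N) (n - psize p) p) x +
    (\<Sum>s | s \<in> {1..n} \<and> addable s p. visit_prob q n N p * h * column_weight q N p s
        * spmf (run q N (n - psize (add_box s p)) (add_box s p)) x)"
\<comment> \<open>In the first case the procedure has stopped and \<open>h = 0\<close>; in the
  second both probabilities vanish. Otherwise \<open>column_pmf\<close> has the prescribed
  weights.\<close>
proof (cases "psize p = n \<or> N < col p 1")
  case True
  then show ?thesis
  proof
    assume "psize p = n"
    then show ?thesis by (simp add: visit_prob_def h_def run_0)
  next
    assume "N < col p 1"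
    then show ?thesis by (simp add: visit_prob_def stage_prob_def qfall_eq_0)
  qed
next
  case False
  define m where "m = n - psize p"
  have m: "0 < m" "psize p < n" and c: "col p 1 \<le> N"
    using False assms(2) by (auto simp: m_def)
  have qm: "q ^ m > 1" using m assms(1) by (simp add: one_less_power)
  then have h: "0 \<le> h" "h \<le> 1"
    by (auto simp: h_def m_def[symmetric] field_simps)
  have "spmf (run q N m p) x =
      h * (\<Sum>s | s \<in> {1..n} \<and> addable s p. column_weight q N p s * spmf (run q N (m - 1) (add_box s p)) x)
      + (1 - h) * spmf (run q (Suc N) m p) x"
    unfolding run_pos[OF m(1), of q N] m_def[symmetric]
    unfolding h_def[folded m_def, symmetric] pmf_bind_bernoulli[OF h]
    by (simp add: pmf_bind_column[OF assms(1,3) c m(2)])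
  also have "(\<Sum>s | s \<in> {1..n} \<and> addable s p. column_weight q N p s * spmf (run q N (m - 1) (add_box s p)) x)
      = (\<Sum>s | s \<in> {1..n} \<and> addable s p. column_weight q N p s
          * spmf (run q N (n - psize (add_box s p)) (add_box s p)) x)"
    by (intro sum.cong refl) (auto simp: psize_add_box m_def)
  finally have E: "spmf (run q N m p) x =
      h * (\<Sum>s | s \<in> {1..n} \<and> addable s p. column_weight q N p s
          * spmf (run q N (n - psize (add_box s p)) (add_box s p)) x)
      + (1 - h) * spmf (run q (Suc N) m p) x" .
  have "visit_prob q n N p * spmf (run q N m p) x =
      visit_prob q n N p * (1 - h) * spmf (run q (Suc N) m p) x +
      (\<Sum>s | s \<in> {1..n} \<and> addable s p. visit_prob q n N p * h * column_weight q N p s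
        * spmf (run q N (n - psize (add_box s p)) (add_box s p)) x)"
    by (simp only: E distrib_left sum_distrib_left mult_ac add_ac)
  moreover have "visit_prob q n N p * (1 - h) = stage_prob q n N p"
    using assms(1) by (simp add: visit_prob_def h_def)
  ultimately show ?thesis by (simp add: m_def)
qed

text \<open>The sum of \<open>visit_prob\<close> times the output probability is expanded backwards
  by \<open>visit_prob_balance\<close> and forwards by \<open>visit_prob_run\<close>. The box-adding
  terms are one double sum, indexed by target or by source, and cancel.\<close>

lemma sum_stage_prob_step:
  assumes "q > 1"
  shows "(\<Sum>p | psize p \<le> n. stage_prob q n N p * spmf (run q (Suc N) (n - psize p) p) x) =
         (\<Sum>p | psize p \<le> n. stage_prob q n (Suc N) p * spmf (run q (Suc (Suc N)) (n - psize p) p) x)"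
    (is "?L = ?R")
proof -
  define P where "P = {p. psize p \<le> n}"
  define F where "F p s = visit_prob q n (Suc N) p * (1 - 1 / q ^ (n - psize p))
     * column_weight q (Suc N) p s" for p s
  define R where "R p = spmf (run q (Suc N) (n - psize p) p) x" for p
  have fin: "finite P" by (simp add: P_def finite_psize_le)
  have F0: "psize p < n" if "F p s \<noteq> 0" for p s
    using that by (rule contrapos_np) (simp add: F_def)
  have "(\<Sum>p\<in>P. visit_prob q n (Suc N) p * R p) =
      ?R + (\<Sum>p\<in>P. \<Sum>s | s \<in> {1..n} \<and> addable s p. F p s * R (add_box s p))"
    unfolding P_def sum.distrib[symmetric]
    by (intro sum.cong refl) (simp add: R_def F_def visit_prob_run[OF assms])
  moreover have "(\<Sum>p\<in>P. visit_prob q n (Suc N) p * R p) =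
      ?L + (\<Sum>p\<in>P. \<Sum>s\<in>set_mset (parts p). F (remove_box s p) s * R p)"
    unfolding P_def sum.distrib[symmetric]
    by (intro sum.cong refl)
       (simp add: R_def F_def visit_prob_balance[OF assms] distrib_right sum_distrib_right)
  moreover have "(\<Sum>p\<in>P. \<Sum>s | s \<in> {1..n} \<and> addable s p. F p s * R (add_box s p)) =
      (\<Sum>p\<in>P. \<Sum>s\<in>set_mset (parts p). F (remove_box s p) s * R p)"
  proof -
    let ?X = "SIGMA p:P. {s. s \<in> {1..n} \<and> addable s p}"
    \<comment> \<open>Sources of size \<open>n\<close> have heads probability zero. Dropping them
      keeps every target inside \<open>P\<close>, so adding a box is a bijection onto
      \<open>?Y\<close>.\<close>
    let ?X' = "{(p, s). psize p < n \<and> s \<in> {1..n} \<and> addable s p}"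
    let ?Y = "SIGMA p:P. set_mset (parts p)"
    have "(\<Sum>p\<in>P. \<Sum>s | s \<in> {1..n} \<and> addable s p. F p s * R (add_box s p)) =
        (\<Sum>(p, s)\<in>?X. F p s * R (add_box s p))"
      using fin by (subst sum.Sigma) auto
    also have "\<dots> = (\<Sum>(p, s)\<in>?X'. F p s * R (add_box s p))"
      using fin by (intro sum.mono_neutral_right finite_SigmaI) (auto simp: P_def dest: F0)
    also have "\<dots> = (\<Sum>(p, s)\<in>?Y. F (remove_box s p) s * R p)"
    proof (rule sum.reindex_bij_witness[where i = "\<lambda>(p, s). (remove_box s p, s)"
          and j = "\<lambda>(p, s). (add_box s p, s)"], goal_cases)
      case (1 a)
      then show ?case by (auto simp: remove_add_box)
    next
      case (2 a)
      then show ?case by (auto simp: psize_add_box part_add_box P_def)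
    next
      case (3 b)
      then show ?case by (auto simp: add_remove_box)
    next
      case (4 b)
      then obtain p s where b: "b = (p, s)" "s \<in># parts p" "psize p \<le> n"
        by (auto simp: P_def)
      then show ?case
        using add_remove_box(2)[OF b(2)] psize_remove_box[OF b(2)] part_le_psize[OF b(2)]
          part_pos[OF b(2)] by auto
    next
      case (5 a)
      then show ?case by (auto simp: remove_add_box)
    qed
    also have "\<dots> = (\<Sum>p\<in>P. \<Sum>s\<in>set_mset (parts p). F (remove_box s p) s * R p)"
      using fin by (subst sum.Sigma) auto
    finally show ?thesis .
  qed
  ultimately show ?thesis by simp
qed

lemma spmf_procedure_output_eq_sum:
  assumes "q > 1"
  shows "spmf (procedure_output q n) x =
    (\<Sum>p | psize p \<le> n. stage_prob q n N p * spmf (run q (Suc N) (n - psize p) p) x)"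
proof (induction N)
  case 0
  have "col p 1 > 0" if ne: "p \<noteq> empty_partition" for p
  proof -
    obtain s where "s \<in># parts p"
      using ne by (rule obtain_part)
    then have "s \<in># {#j \<in># parts p. 1 \<le> j#}"
      using part_pos by auto
    then show ?thesis
      unfolding col_def by (metis empty_iff gr0I set_mset_empty size_eq_0_iff_empty)
  qed
  \<comment> \<open>At the fictitious stage 0, \<open>qfall q 0\<close> vanishes on nonempty first
    columns, so all mass sits at the empty partition.\<close>
  then have "(\<Sum>p | psize p \<le> n. stage_prob q n 0 p * spmf (run q (Suc 0) (n - psize p) p) x) =
      (\<Sum>p\<in>{empty_partition}. stage_prob q n 0 p * spmf (run q (Suc 0) (n - psize p) p) x)"
    by (intro sum.mono_neutral_right finite_psize_le) (auto simp: stage_prob_def qfall_eq_0)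
  also have "\<dots> = spmf (run q 1 n empty_partition) x"
    using qfac_pos[OF assms, of n]
    by (simp add: stage_prob_def gl_weight_def qfall_def col_eq_0)
  finally show ?case by (simp add: procedure_output_def)
next
  case (Suc N)
  then show ?case using sum_stage_prob_step[OF assms] by simp
qed

section \<open>The output law, termination and normalisation\<close>

text \<open>Let \<open>N\<close> tend to infinity in \<open>spmf_procedure_output_eq_sum\<close>:
  terms with boxes still missing decay geometrically, and for complete partitions
  \<open>qfall\<close> tends to 1.\<close>

lemma spmf_procedure_output:
  assumes "q > 1"
  shows "spmf (procedure_output q n) x =
    (if psize x = n then qfac q n * q ^ n * gl_weight q x else 0)"
proof -
  have lim: "(\<lambda>N. stage_prob q n N p * spmf (run q (Suc N) (n - psize p) p) x) \<longlonglongrightarrow>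
      (if p = x \<and> psize x = n then qfac q n * q ^ n * gl_weight q x else 0)"
    if p: "p \<in> {p. psize p \<le> n}" for p
  proof (cases "psize p = n")
    case True
    have "(\<lambda>N. qfac q n * q ^ n * (gl_weight q p * qfall q N (col p 1)) * indicator {p} x) \<longlonglongrightarrow>
        qfac q n * q ^ n * (gl_weight q p * 1) * indicator {p} x"
      by (intro tendsto_intros qfall_tendsto_1 assms)
    then show ?thesis
      using True by (auto simp: stage_prob_def run_0 indicator_def split: if_splits)
  next
    case False
    define m where "m = n - psize p"
    have m: "0 < m" using False p by (simp add: m_def)
    have "0 \<le> inverse (q ^ m)" "inverse (q ^ m) < 1"
      using one_less_power[OF assms m] assms by (simp_all add: inverse_less_1_iff)
    then have "(\<lambda>N. inverse (q ^ m) ^ N) \<longlonglongrightarrow> 0"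
      by (rule LIMSEQ_realpow_zero)
    then have "(\<lambda>N. qfac q n / qfac q m * q ^ psize p * inverse (q ^ m) ^ N
        * (gl_weight q p * qfall q N (col p 1))) \<longlonglongrightarrow>
        qfac q n / qfac q m * q ^ psize p * 0 * (gl_weight q p * 1)"
      by (intro tendsto_mult tendsto_const qfall_tendsto_1 assms)
    moreover have "stage_prob q n N p = qfac q n / qfac q m * q ^ psize p * inverse (q ^ m) ^ N
        * (gl_weight q p * qfall q N (col p 1))" for N
      by (simp add: stage_prob_def m_def divide_inverse power_inverse mult.commute[of N] power_mult)
    ultimately have "(\<lambda>N. stage_prob q n N p) \<longlonglongrightarrow> 0" by simp
    then have "(\<lambda>N. stage_prob q n N p * spmf (run q (Suc N) (n - psize p) p) x) \<longlonglongrightarrow> 0"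
    proof (rule Lim_null_comparison[rotated, OF tendsto_norm_zero], intro always_eventually allI)
      fix N
      show "norm (stage_prob q n N p * spmf (run q (Suc N) (n - psize p) p) x)
          \<le> norm (stage_prob q n N p)"
        unfolding norm_mult by (intro mult_left_le) (simp_all add: pmf_le_1)
    qed
    then show ?thesis using False by auto
  qed
  have "(\<lambda>N. \<Sum>p | psize p \<le> n. stage_prob q n N p * spmf (run q (Suc N) (n - psize p) p) x) \<longlonglongrightarrow>
      (\<Sum>p | psize p \<le> n. if p = x \<and> psize x = n then qfac q n * q ^ n * gl_weight q x else 0)"
    by (rule tendsto_sum[OF lim])
  moreover have "(\<Sum>p | psize p \<le> n. if p = x \<and> psize x = n then qfac q n * q ^ n * gl_weight q x else 0) =
      (if psize x = n then qfac q n * q ^ n * gl_weight q x else 0)"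
    using finite_psize_le[of n] by auto
  ultimately show ?thesis
    by (simp add: LIMSEQ_const_iff flip: spmf_procedure_output_eq_sum[OF assms])
qed

text \<open>By induction on \<open>m\<close>, divergence requires tails forever at the current
  \<open>m\<close>; its probability is at most \<open>(1 - h) ^ k\<close> for every
  \<open>k\<close>.\<close>

lemma lossless_run:
  assumes "q > 1"
  shows "lossless_spmf (run q N m p)"
proof (induction m arbitrary: N p)
  case 0
  then show ?case by (simp add: run_0)
next
  case (Suc m)
  define h where "h = 1 - 1 / q ^ Suc m"
  have "q ^ Suc m > 1" using assms by (intro one_less_power) auto
  then have h: "0 < h" "h \<le> 1"
    by (auto simp: h_def field_simps simp del: power_Suc)
  have step: "pmf (run q M (Suc m) p) None = (1 - h) * pmf (run q (Suc M) (Suc m) p) None" for M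
  proof -
    have "pmf (bind_pmf (column_pmf q M p) (\<lambda>S. run q M m (add_box S p))) None = 0"
      using Suc by (simp add: pmf_bind lossless_iff_pmf_None)
    then show ?thesis
      using h unfolding run_pos[OF zero_less_Suc, of q M] h_def[symmetric]
      by (subst pmf_bind_bernoulli) auto
  qed
  have "pmf (run q N (Suc m) p) None = (1 - h) ^ k * pmf (run q (N + k) (Suc m) p) None" for k
  proof (induction k)
    case (Suc k)
    then show ?case by (simp add: step[of "N + k"])
  qed simp
  moreover have "(1 - h) ^ k * pmf (run q (N + k) (Suc m) p) None \<le> (1 - h) ^ k" for k
    using h by (intro mult_left_le) (auto simp: pmf_le_1)
  ultimately have le: "pmf (run q N (Suc m) p) None \<le> (1 - h) ^ k" for k
    by metis
  have "(\<lambda>k. (1 - h) ^ k) \<longlonglongrightarrow> 0"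
    using h by (intro LIMSEQ_power_zero) auto
  then have "pmf (run q N (Suc m) p) None \<le> 0"
    using le by (intro LIMSEQ_le_const) auto
  then show ?case
    using pmf_nonneg[of "run q N (Suc m) p" None] by (simp add: lossless_iff_pmf_None)
qed

text \<open>Termination makes the output law a probability on partitions of \<open>n\<close>, so its
  explicit values sum to 1.\<close>

lemma sum_gl_weight:
  assumes "q > 1"
  shows "qfac q n * q ^ n * (\<Sum>p | psize p = n. gl_weight q p) = 1"
proof -
  have fin: "finite {p. psize p = n}"
    using finite_psize_le[of n] by (rule rev_finite_subset) auto
  have "1 = weight_spmf (procedure_output q n)"
    using lossless_run[OF assms] by (simp add: procedure_output_def lossless_spmf_def)
  also have "\<dots> = measure (measure_spmf (procedure_output q n)) {p. psize p = n}"
    unfolding weight_spmf_def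
    by (rule measure_spmf.finite_measure_eq_AE)
       (auto simp: AE_measure_spmf_iff in_set_spmf_iff_spmf spmf_procedure_output[OF assms] split: if_splits)
  also have "\<dots> = (\<Sum>p | psize p = n. spmf (procedure_output q n) p)"
    using fin by (simp add: measure_measure_spmf_conv_measure_pmf measure_measure_pmf_finite
        sum.reindex)
  finally show ?thesis
    by (simp add: spmf_procedure_output[OF assms] sum_distrib_left)
qed

text \<open>Conditioning divides by this product. Comparison with a geometric series gives absolute
  convergence, and a convergent product of nonzero factors is nonzero.\<close>

lemma euler_product_pos:
  fixes q u :: real
  assumes "q > 1" "0 < u" "u < 1"
  shows "(\<Prod>r. 1 - u / q ^ Suc r) > 0"
proof -
  have lt: "u / q ^ Suc r < 1" for r
  proof -
    have "u < q ^ Suc r"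
      using one_less_power[OF assms(1), of "Suc r"] assms(3) by simp
    then show ?thesis using assms by (simp add: divide_less_eq_1)
  qed
  define F where "F r = 1 - u / q ^ Suc r" for r
  have F_pos: "F r > 0" for r
    using lt[of r] by (simp add: F_def)
  have "summable (\<lambda>r. (u / q) * (1 / q) ^ r)"
    using assms by (intro summable_mult summable_geometric) auto
  moreover have "(\<lambda>r. (u / q) * (1 / q) ^ r) = (\<lambda>r. norm (F r - 1))"
    using assms by (simp add: F_def power_one_over)
  ultimately have "abs_convergent_prod F"
    by (simp only: abs_convergent_prod_conv_summable)
  then have conv: "convergent_prod F"
    by (rule abs_convergent_prod_imp_convergent_prod)
  have lim: "(\<lambda>n. \<Prod>r\<le>n. F r) \<longlonglongrightarrow> prodinf F"
    using conv by (rule convergent_prod_LIMSEQ)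
  have "prodinf F \<noteq> 0"
    using conv by (rule prodinf_nonzero) (use F_pos in \<open>simp add: less_imp_neq[symmetric]\<close>)
  moreover have "prodinf F \<ge> 0"
    using lim by (rule LIMSEQ_le_const) (use F_pos in \<open>simp add: prod_nonneg less_imp_le\<close>)
  ultimately show ?thesis by (simp add: F_def[abs_def])
qed

text \<open>This reduces the equality of measures in the theorem to a pointwise equality of
  densities.\<close>

lemma measure_spmf_eq_density:
  "measure_spmf p = density (count_space UNIV) (\<lambda>x. ennreal (spmf p x))"
proof (rule measure_eqI)
  fix A
  show "emeasure (measure_spmf p) A = emeasure (density (count_space UNIV) (\<lambda>x. ennreal (spmf p x))) A"
    using nn_integral_measure_spmf[of p "indicator A"] by (simp add: emeasure_density)
qed simp

theorem theorem8:
  fixes q u :: real and n :: nat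
  assumes "q > 1" and "0 < u" and "u < 1"
  shows "lossless_spmf (procedure_output q n) \<and>
         set_spmf (procedure_output q n) \<subseteq> {p. psize p = n} \<and>
         measure_spmf (procedure_output q n) = uniform_measure (M_GL u q) {p. psize p = n}"
proof (intro conjI)
  show "lossless_spmf (procedure_output q n)"
    using lossless_run[OF assms(1)] by (simp add: procedure_output_def)
  show "set_spmf (procedure_output q n) \<subseteq> {p. psize p = n}"
    by (auto simp: in_set_spmf_iff_spmf spmf_procedure_output[OF assms(1)] split: if_splits)
  define E where "E = (\<Prod>r. 1 - u / q ^ Suc r)"
  define A where "A = {p. psize p = n}"
  \<comment> \<open>\<open>1 / c\<close> is the total weight of the partitions of \<open>n\<close>,
    by \<open>sum_gl_weight\<close>.\<close>
  define c where "c = qfac q n * q ^ n"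
  have E: "E > 0" using euler_product_pos[OF assms] by (simp add: E_def)
  have c: "c > 0" using qfac_pos[OF assms(1)] assms by (simp add: c_def)
  have mass: "GL_mass u q p = E * (u ^ psize p * gl_weight q p)" for p
    by (simp add: GL_mass_def E_def gl_weight_def)
  have mass0: "GL_mass u q p \<ge> 0" for p
    using E assms gl_weight_pos[OF assms(1), of p] by (simp add: mass less_imp_le)
  have fin: "finite A"
    unfolding A_def using finite_psize_le[of n] by (rule rev_finite_subset) auto
  have "c * (\<Sum>p\<in>A. gl_weight q p) = 1"
    using sum_gl_weight[OF assms(1), of n] by (simp add: c_def A_def)
  then have Z: "(\<Sum>p\<in>A. gl_weight q p) = 1 / c"
    using c by (simp add: field_simps)
  have "emeasure (M_GL u q) A = ennreal (\<Sum>p\<in>A. GL_mass u q p)"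
    using fin mass0 by (simp add: M_GL_def emeasure_point_measure_finite2 sum_ennreal)
  also have "(\<Sum>p\<in>A. GL_mass u q p) = E * u ^ n * (\<Sum>p\<in>A. gl_weight q p)"
    unfolding sum_distrib_left by (intro sum.cong refl) (simp add: mass A_def)
  finally have em: "emeasure (M_GL u q) A = ennreal (E * u ^ n / c)"
    by (simp add: Z)
  have "uniform_measure (M_GL u q) A =
      density (count_space UNIV) (\<lambda>p. ennreal (GL_mass u q p) * (indicator A p / ennreal (E * u ^ n / c)))"
    unfolding uniform_measure_def em
    by (simp add: M_GL_def point_measure_def density_density_eq)
  also have "\<dots> = density (count_space UNIV) (\<lambda>p. ennreal (spmf (procedure_output q n) p))"
  proof (intro arg_cong[where f = "density (count_space UNIV)"] ext)
    fix p
    show "ennreal (GL_mass u q p) * (indicator A p / ennreal (E * u ^ n / c)) =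
        ennreal (spmf (procedure_output q n) p)"
    proof (cases "p \<in> A")
      case True
      \<comment> \<open>On \<open>A\<close> the factor \<open>E * u ^ n\<close> occurs in both the
        mass of \<open>p\<close> and that of \<open>A\<close>, so it cancels and leaves
        \<open>c * gl_weight q p\<close>.\<close>
      have "GL_mass u q p * (1 / (E * u ^ n / c)) = spmf (procedure_output q n) p"
        using True E assms c by (simp add: mass A_def spmf_procedure_output c_def)
      moreover have "(1 :: ennreal) / ennreal (E * u ^ n / c) = ennreal (1 / (E * u ^ n / c))"
        using E assms c by (simp add: divide_ennreal[symmetric] del: divide_divide_eq_right)
      ultimately show ?thesis
        using True mass0 by (simp add: ennreal_mult''[symmetric] ennreal_mult'[symmetric])
    next
      case False
      then show ?thesis
        by (simp add: spmf_procedure_output[OF assms(1)] A_def)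
    qed
  qed
  also have "\<dots> = measure_spmf (procedure_output q n)"
    by (simp add: measure_spmf_eq_density)
  finally show "measure_spmf (procedure_output q n) = uniform_measure (M_GL u q) {p. psize p = n}"
    by (simp add: A_def)
qed

end
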